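(* Let $F$ be a social choice correspondence. Assume that $F$ satisfies weak set-monotonicity and upward sensitivity. Then $F$ is $\Omega^F$-$\mathbf{K}$-manipulable.
   Context: Standing setting: $A$ (alternatives) and $I$ (individuals) are finite sets with $|A|\ge 2$, $|I|\ge 2$. $P_0(X)$ is the set of nonempty subsets of $X$. For a relation $R$ on a set $X$, $x\succeq_R y$ means $(x,y)\in R$, and $x\succ_R y$ means $(x,y)\in R$ and $(y,x)\notin R$. $\mathcal{L}(A)$ is the set of linear orders (complete, transitive, antisymmetric relations) on $A$; for $q\in\mathcal{L}(A)$, $\mathrm{rank}_q(x)=|\{y\in A: y\succeq_q x\}|$ (so rank $1$ is best). For $J\subseteq I$, $\mathcal{L}(A)^J$ is the set of functions $J\to\mathcal{L}(A)$. For $i\in I$, $\overline{p}\in\mathcal{L}(A)^{I\setminus\{i\}}$, $q\in\mathcal{L}(A)$, $(\overline{p},q[i])\in\mathcal{L}(A)^I$ is the profile equal to $q$ at $i$ and to $\overline{p}(j)$ at every $j\ne i$. A social choice correspondence (scc) is a function $F:\mathcal{L}(A)^I\to P_0(A)$. For a bijection $\psi:A\to A$, $\psi q=\{(x,y)\in A^2:(\psi^{-1}(x),\psi^{-1}(y))\in q\}$. The transposition exchanging $x$ and $y$ is the bijection of $A$ swapping $x$ and $y$ and fixing everything else. Weak set-monotonicity: $F$ satisfies it if, for every $i\in I$, $\overline{p}\in\mathcal{L}(A)^{I\setminus\{i\}}$, $q\in\mathcal{L}(A)$ and $x,y,z\in A$ such that $F(\overline{p},q[i])=\{z\}$ and $\mathrm{rank}_q(x)+1=\mathrm{rank}_q(y)<\mathrm{rank}_q(z)$,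 we have $F(\overline{p},\psi q[i])\subseteq\{z,y\}$, where $\psi$ is the transposition exchanging $x$ and $y$. Upward sensitivity: $F$ satisfies it if there exist $i\in I$, $\overline{p}\in\mathcal{L}(A)^{I\setminus\{i\}}$, $q\in\mathcal{L}(A)$ and $x,y,z\in A$ such that $F(\overline{p},q[i])=\{z\}$, $\mathrm{rank}_q(x)+1=\mathrm{rank}_q(y)<\mathrm{rank}_q(z)$, and $y\in F(\overline{p},\psi q[i])$, where $\psi$ is the transposition exchanging $x$ and $y$. Kelly extension rule: for $q\in\mathcal{L}(A)$, $\mathbf{K}(q)$ is the relation on $P_0(A)$ given by $(B,C)\in\mathbf{K}(q)$ iff $B=C$ or $x\succeq_q y$ for all $x\in B$, $y\in C$. Winner information: for $i\in I$, $q\in\mathcal{L}(A)$, $\Omega^F_i(q)=\big\{\{\overline{p}\in\mathcal{L}(A)^{I\setminus\{i\}}:F(\overline{p},q[i])=X\}: X\in\mathrm{Im}(F)\big\}\setminus\{\varnothing\}$. $F$ is $\Omega^F$-$\mathbf{K}$-manipulable if there exist $i\in I$, $q,q'\in\mathcal{L}(A)$ and $\omega\in\Omega^F_i(q)$ such that $F(\overline{p}',q'[i])\succ_{\mathbf{K}(q)}F(\overline{p}',q[i])$ for some $\overline{p}'\in\omega$, and $F(\overline{p},q'[i])\succeq_{\mathbf{K}(q)}F(\overline{p},q[i])$ for every $\overline{p}\in\omega$. *)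

theory Defs
  imports Main "HOL-Library.FuncSet" "HOL-Combinatorics.Transposition"
begin

(* A relation R contains (x, y) iff x is weakly preferred to y.  Hence the best element of a
   linear order in this file is the least element in the usual reading of linear_order_on. *)

definition strictly_prefers :: "'a rel \<Rightarrow> 'a \<Rightarrow> 'a \<Rightarrow> bool" where
  "strictly_prefers R x y \<longleftrightarrow> (x, y) \<in> R \<and> (y, x) \<notin> R"

definition nonempty_subsets :: "'a set \<Rightarrow> 'a set set" where
  "nonempty_subsets X = {B. B \<subseteq> X \<and> B \<noteq> {}}"

definition lin_orders :: "'a set \<Rightarrow> 'a rel set" where
  "lin_orders A = {q. linear_order_on A q}"

definition rank :: "'a set \<Rightarrow> 'a rel \<Rightarrow> 'a \<Rightarrow> nat" where
  "rank A q x = card {y \<in> A. (y, x) \<in> q}"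

(* Functions from J to the linear orders on A.  They are extensional (undefined outside J), so
   that distinct elements of the set represent distinct functions on J.  For i in I and a profile p
   on I - {i}, the update p(i := q) is the profile on I that extends p by q at i. *)
definition profiles :: "'i set \<Rightarrow> 'a set \<Rightarrow> ('i \<Rightarrow> 'a rel) set" where
  "profiles J A = (J \<rightarrow>\<^sub>E lin_orders A)"

definition scc :: "'i set \<Rightarrow> 'a set \<Rightarrow> (('i \<Rightarrow> 'a rel) \<Rightarrow> 'a set) \<Rightarrow> bool" where
  "scc I A F \<longleftrightarrow> F \<in> profiles I A \<rightarrow> nonempty_subsets A"

definition relabel :: "'a set \<Rightarrow> ('a \<Rightarrow> 'a) \<Rightarrow> 'a rel \<Rightarrow> 'a rel" where
  "relabel A \<psi> q = {(x, y) \<in> A \<times> A. (inv_into A \<psi> x, inv_into A \<psi> y) \<in> q}"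

definition weak_set_monotonicity ::
  "'i set \<Rightarrow> 'a set \<Rightarrow> (('i \<Rightarrow> 'a rel) \<Rightarrow> 'a set) \<Rightarrow> bool" where
  "weak_set_monotonicity I A F \<longleftrightarrow>
     (\<forall>i\<in>I. \<forall>p\<in>profiles (I - {i}) A. \<forall>q\<in>lin_orders A. \<forall>x\<in>A. \<forall>y\<in>A. \<forall>z\<in>A.
        F (p(i := q)) = {z} \<and> rank A q x + 1 = rank A q y \<and> rank A q y < rank A q z
        \<longrightarrow> F (p(i := relabel A (transpose x y) q)) \<subseteq> {z, y})"

definition upward_sensitivity ::
  "'i set \<Rightarrow> 'a set \<Rightarrow> (('i \<Rightarrow> 'a rel) \<Rightarrow> 'a set) \<Rightarrow> bool" where
  "upward_sensitivity I A F \<longleftrightarrow>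
     (\<exists>i\<in>I. \<exists>p\<in>profiles (I - {i}) A. \<exists>q\<in>lin_orders A. \<exists>x\<in>A. \<exists>y\<in>A. \<exists>z\<in>A.
        F (p(i := q)) = {z} \<and> rank A q x + 1 = rank A q y \<and> rank A q y < rank A q z
        \<and> y \<in> F (p(i := relabel A (transpose x y) q)))"

definition kelly :: "'a set \<Rightarrow> 'a rel \<Rightarrow> 'a set rel" where
  "kelly A q = {(B, C) \<in> nonempty_subsets A \<times> nonempty_subsets A.
     B = C \<or> (\<forall>x\<in>B. \<forall>y\<in>C. (x, y) \<in> q)}"

definition winner_info ::
  "'i set \<Rightarrow> 'a set \<Rightarrow> (('i \<Rightarrow> 'a rel) \<Rightarrow> 'a set) \<Rightarrow> 'i \<Rightarrow> 'a rel \<Rightarrow> ('i \<Rightarrow> 'a rel) set set" where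
  "winner_info I A F i q =
     {{p \<in> profiles (I - {i}) A. F (p(i := q)) = X} |X. X \<in> F ` profiles I A} - {{}}"

definition manipulable ::
  "'i set \<Rightarrow> 'a set \<Rightarrow> ('i \<Rightarrow> 'a rel \<Rightarrow> ('i \<Rightarrow> 'a rel) set set) \<Rightarrow> ('a rel \<Rightarrow> 'a set rel)
    \<Rightarrow> (('i \<Rightarrow> 'a rel) \<Rightarrow> 'a set) \<Rightarrow> bool" where
  "manipulable I A \<Omega> K F \<longleftrightarrow>
     (\<exists>i\<in>I. \<exists>q\<in>lin_orders A. \<exists>q'\<in>lin_orders A. \<exists>\<omega>\<in>\<Omega> i q.
        (\<exists>p\<in>\<omega>. strictly_prefers (K q) (F (p(i := q'))) (F (p(i := q)))) \<and>
        (\<forall>p\<in>\<omega>. (F (p(i := q')), F (p(i := q))) \<in> K q))"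

end

theory Submission
  imports Defs
begin

text \<open>The situation provided by upward sensitivity is itself a manipulation. There an
  individual with true order \<open>q\<close> sees {z} elected, and swapping the adjacent x and y,
  both ranked above z, brings y into the outcome. Knowing only that the sincere outcome is {z}, the
  individual considers every profile of the others compatible with it. Weak set-monotonicity
  confines the outcome of the swap to {z, y} at all of them, and since y beats z in
  \<open>q\<close>, no such outcome is Kelly-worse than {z}. \<open>relabel_in_lin_orders\<close>
  makes the swapped order an admissible report; \<open>strictly_prefers_if_rank_less\<close> turns
  ranks into preferences.\<close>

lemma relabel_in_lin_orders:
  assumes "bij_betw \<psi> A A" and "q \<in> lin_orders A"
  shows "relabel A \<psi> q \<in> lin_orders A"
proof -
  let ?g = "inv_into A \<psi>"
  have g: "bij_betw ?g A A"
    using assms(1) by (rule bij_betw_inv_into)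
  then have gA: "?g x \<in> A" if "x \<in> A" for x
    using that by (rule bij_betwE[rule_format])
  \<comment> \<open>Injectivity of the inverse is what carries antisymmetry and totality from
    \<open>q\<close> to its pullback.\<close>
  have inj: "x = y" if "?g x = ?g y" "x \<in> A" "y \<in> A" for x y
    using g that by (auto simp: bij_betw_def inj_on_def)
  have q: "q \<subseteq> A \<times> A" "refl_on A q" "trans q" "antisym q" "total_on A q"
    using assms(2)
    by (auto simp: lin_orders_def linear_order_on_def partial_order_on_def preorder_on_def)
  have "relabel A \<psi> q \<subseteq> A \<times> A"
    by (auto simp: relabel_def)
  moreover have "refl_on A (relabel A \<psi> q)"
    using q(2) gA by (auto simp: relabel_def refl_on_def)
  moreover have "trans (relabel A \<psi> q)"
    using q(3) by (auto simp: relabel_def intro!: transI dest: transD)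
  moreover have "antisym (relabel A \<psi> q)"
    using q(4) inj by (auto simp: relabel_def intro!: antisymI dest: antisymD)
  moreover have "total_on A (relabel A \<psi> q)"
    using q(5) gA inj unfolding relabel_def total_on_def by blast
  ultimately show ?thesis
    by (simp add: lin_orders_def linear_order_on_def partial_order_on_def preorder_on_def)
qed

lemma strictly_prefers_if_rank_less:
  assumes "finite A" and "q \<in> lin_orders A" and "y \<in> A" and "z \<in> A"
    and "rank A q y < rank A q z"
  shows "strictly_prefers q y z"
proof -
  have q: "trans q" "total_on A q"
    using assms(2)
    by (auto simp: lin_orders_def linear_order_on_def partial_order_on_def preorder_on_def)
  \<comment> \<open>Otherwise, by transitivity, everything weakly above z is weakly above y, so z
    could not have the larger rank.\<close>
  have "(z, y) \<notin> q"
  proof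
    assume "(z, y) \<in> q"
    then have "{w \<in> A. (w, z) \<in> q} \<subseteq> {w \<in> A. (w, y) \<in> q}"
      using q(1) by (auto dest: transD)
    then have "rank A q z \<le> rank A q y"
      unfolding rank_def using assms(1) by (intro card_mono) auto
    with assms(5) show False by simp
  qed
  moreover have "y \<noteq> z"
    using assms(5) by auto
  ultimately show ?thesis
    using q(2) assms(3,4) by (auto simp: strictly_prefers_def total_on_def)
qed

theorem theorem14:
  fixes A :: "'a set" and I :: "'i set" and F :: "('i \<Rightarrow> 'a rel) \<Rightarrow> 'a set"
  assumes "finite A" and "card A \<ge> 2"
    and "finite I" and "card I \<ge> 2"
    and "scc I A F"
    and "weak_set_monotonicity I A F"
    and "upward_sensitivity I A F"
  shows "manipulable I A (winner_info I A F) (kelly A) F"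
proof -
  obtain i p q x y z where i: "i \<in> I" and p: "p \<in> profiles (I - {i}) A"
    and q: "q \<in> lin_orders A" and xyz: "x \<in> A" "y \<in> A" "z \<in> A"
    and Fp: "F (p(i := q)) = {z}" and rk: "rank A q x + 1 = rank A q y" "rank A q y < rank A q z"
    and yF: "y \<in> F (p(i := relabel A (transpose x y) q))"
    using assms(7) unfolding upward_sensitivity_def by blast
  define q' where "q' = relabel A (transpose x y) q"
  \<comment> \<open>The information cell of \<open>p\<close>: all that the winner set {z} reveals
    about the others.\<close>
  define \<omega> where "\<omega> = {p \<in> profiles (I - {i}) A. F (p(i := q)) = {z}}"
  have q': "q' \<in> lin_orders A"
    unfolding q'_def using xyz q
    by (intro relabel_in_lin_orders) (auto simp: bij_betw_def transpose_def inj_on_def)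
  have upd: "r(i := s) \<in> profiles I A" if "r \<in> profiles (I - {i}) A" "s \<in> lin_orders A" for r s
    using PiE_fun_upd[of s "\<lambda>_. lin_orders A" i r "I - {i}"] that i
    by (simp add: profiles_def insert_absorb)
  have pref: "(y, z) \<in> q" "(z, y) \<notin> q"
    using strictly_prefers_if_rank_less[OF assms(1) q xyz(2,3) rk(2)]
    by (auto simp: strictly_prefers_def)
  have zz: "(z, z) \<in> q"
    using q xyz(3)
    by (auto simp: lin_orders_def linear_order_on_def partial_order_on_def preorder_on_def
        dest: refl_onD)
  have p\<omega>: "p \<in> \<omega>"
    using p Fp by (simp add: \<omega>_def)
  \<comment> \<open>The outcome is {z}, {y} or {z, y}; each is Kelly-related to {z} because y and z
    are both weakly above z.\<close>
  have weak: "(F (r(i := q')), F (r(i := q))) \<in> kelly A q" if "r \<in> \<omega>" for r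
  proof -
    have r: "r \<in> profiles (I - {i}) A" "F (r(i := q)) = {z}"
      using that by (auto simp: \<omega>_def)
    have "F (r(i := q')) \<subseteq> {z, y}"
      using assms(6) i r q xyz rk unfolding weak_set_monotonicity_def q'_def by blast
    moreover have "F (r(i := q')) \<in> nonempty_subsets A"
      using assms(5) upd[OF r(1) q'] by (auto simp: scc_def)
    moreover have "{z} \<in> nonempty_subsets A"
      using xyz(3) by (simp add: nonempty_subsets_def)
    ultimately show ?thesis
      using r(2) pref(1) zz by (auto simp: kelly_def)
  qed
  \<comment> \<open>The new outcome contains y, so it differs from {z}, and the pair (z, y) violates
    the elementwise comparison.\<close>
  have "(F (p(i := q)), F (p(i := q'))) \<notin> kelly A q"
    using yF Fp pref zz by (auto simp: kelly_def q'_def)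
  then have strict: "strictly_prefers (kelly A q) (F (p(i := q'))) (F (p(i := q)))"
    using weak[OF p\<omega>] by (simp add: strictly_prefers_def)
  have "{z} \<in> F ` profiles I A"
    using upd[OF p q] Fp by (metis imageI)
  \<comment> \<open>Membership of \<open>p\<close> keeps the cell from being the excluded empty
    set.\<close>
  then have "\<omega> \<in> winner_info I A F i q"
    using p\<omega> unfolding winner_info_def \<omega>_def by blast
  then show ?thesis
    unfolding manipulable_def using i q q' strict weak p\<omega> by blast
qed

end
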